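(* Let $R$ be a commutative ring and let $X$ be a $1$-dimensional directed simplicial complex with (distinct) vertices $v_0,v_1,\dots,v_n$, $n\ge1$, and whose $1$-simplices are exactly $e_0,e_1,\dots,e_n$ (pairwise distinct), where for each $i=0,1,\dots,n$ either $e_i=(v_i,v_{i+1})$ or $e_i=(v_{i+1},v_i)$, and we write $v_{n+1}=v_0$. Then $H_1(X,R)\cong R$. If $R\in\{\mathbb{Z},\mathbb{Q},\mathbb{R}\}$, then $H_1^{\mathrm{Dir}}(X,R)$ is non-trivial if and only if either $e_i=(v_i,v_{i+1})$ for all $i$ or $e_i=(v_{i+1},v_i)$ for all $i$, in which case $H_1^{\mathrm{Dir}}(X,R)\cong R$.
   Context: A directed simplicial complex $X$ on a finite vertex set $V$ is a family of tuples $(x_0,\dots,x_n)$, $n\ge 0$, of elements of $V$ such that, for $n\geq 1$, if $(x_0,\dots,x_n)\in X$ then $(x_0,\dots,\widehat{x_i},\dots,x_n)\in X$ for all $i$ ($\widehat{x_i}$ means $x_i$ is omitted). Repetitions of vertices are allowed, and every vertex belongs to at least one simplex. Tuples of length $n+1$ are called $n$-simplices. $X$ is $1$-dimensional if it has $1$-simplices but no $2$-simplices. For a commutative ring $R$, $C_n(X,R)$ is the free $R$-module with basis the elementary $n$-chains $[x_0,\dots,x_n]$, one for each $n$-simplex; $\partial_n[x_0,\dots,x_n]=\sum_{i=0}^n(-1)^i[x_0,\dots,\widehat{x_i},\dots,x_n]$ for $n>0$, $\partial_0=0$; $Z_n(X,R)=\ker\partial_n$, $B_n(X,R)=\operatorname{Im}\partial_{n+1}$,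 $H_n(X,R)=Z_n(X,R)/B_n(X,R)$. For $R\in\{\mathbb{Z},\mathbb{Q},\mathbb{R}\}$, $Z_n^{\mathrm{Dir}}(X,R)$ is the set of cycles $\sum_i\lambda_ic_i\in Z_n(X,R)$ with each $c_i$ an elementary $n$-chain and each $\lambda_i\ge0$, and $H_n^{\mathrm{Dir}}(X,R)$ is the $R$-submodule of $H_n(X,R)$ generated by the classes of elements of $Z_n^{\mathrm{Dir}}(X,R)$. *)

theory Defs
  imports "HOL-Algebra.Algebra" "HOL-Algebra.Algebraic_Closure_Type" "HOL.Real"
begin

text \<open>
  The record \<^type>\<open>module_ext\<close> extends that of rings; the components \<open>mult\<close> and \<open>one\<close>
  play no role in the locale \<^locale>\<open>module\<close> and are left undefined.
\<close>

definition free_module :: "('r, 'm) ring_scheme \<Rightarrow> 's set \<Rightarrow> ('r, 's \<Rightarrow> 'r) module" where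
  "free_module R S =
    \<lparr>carrier = {c. (\<forall>s\<in>S. c s \<in> carrier R) \<and> (\<forall>s. s \<notin> S \<longrightarrow> c s = \<zero>\<^bsub>R\<^esub>) \<and>
                   finite {s. c s \<noteq> \<zero>\<^bsub>R\<^esub>}},
     monoid.mult = undefined, one = undefined,
     ring.zero = (\<lambda>_. \<zero>\<^bsub>R\<^esub>),
     add = (\<lambda>c d s. c s \<oplus>\<^bsub>R\<^esub> d s),
     module.smult = (\<lambda>a c s. a \<otimes>\<^bsub>R\<^esub> c s)\<rparr>"

definition basis_elem :: "('r, 'm) ring_scheme \<Rightarrow> 's \<Rightarrow> 's \<Rightarrow> 'r" where
  "basis_elem R s = (\<lambda>t. if t = s then \<one>\<^bsub>R\<^esub> else \<zero>\<^bsub>R\<^esub>)"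

definition regular_module :: "('r, 'm) ring_scheme \<Rightarrow> ('r, 'r) module" where
  "regular_module R =
    \<lparr>carrier = carrier R, monoid.mult = monoid.mult R, one = one R,
     ring.zero = ring.zero R, add = add R, module.smult = monoid.mult R\<rparr>"

text \<open>As for \<^const>\<open>FactRing\<close>, the operations on cosets do not choose representatives.\<close>

definition FactModule :: "('r, 'a, 'm) module_scheme \<Rightarrow> 'a set \<Rightarrow> ('r, 'a set) module" where
  "FactModule M N =
    \<lparr>carrier = a_rcosets\<^bsub>M\<^esub> N, monoid.mult = undefined, one = undefined,
     ring.zero = N, add = set_add M,
     module.smult = (\<lambda>a A. \<Union>x\<in>A. N +>\<^bsub>M\<^esub> (a \<odot>\<^bsub>M\<^esub> x))\<rparr>"

definition generated_submodule ::
    "('r, 'm) ring_scheme \<Rightarrow> ('r, 'a, 'n) module_scheme \<Rightarrow> 'a set \<Rightarrow> 'a set" where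
  "generated_submodule R M S = \<Inter>{N. submodule N R M \<and> S \<subseteq> N}"

definition module_isomorphic ::
    "('r, 'm) ring_scheme \<Rightarrow> ('r, 'a, 'n) module_scheme \<Rightarrow> ('r, 'b, 'k) module_scheme \<Rightarrow> bool" where
  "module_isomorphic R M N \<longleftrightarrow>
    (\<exists>h. bij_betw h (carrier M) (carrier N) \<and>
         (\<forall>x\<in>carrier M. \<forall>y\<in>carrier M. h (x \<oplus>\<^bsub>M\<^esub> y) = h x \<oplus>\<^bsub>N\<^esub> h y) \<and>
         (\<forall>a\<in>carrier R. \<forall>x\<in>carrier M. h (a \<odot>\<^bsub>M\<^esub> x) = a \<odot>\<^bsub>N\<^esub> h x))"

definition nontrivial_module :: "('r, 'a, 'n) module_scheme \<Rightarrow> bool" where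
  "nontrivial_module M \<longleftrightarrow> carrier M \<noteq> {\<zero>\<^bsub>M\<^esub>}"

definition omit :: "nat \<Rightarrow> 'v list \<Rightarrow> 'v list" where
  "omit i xs = take i xs @ drop (Suc i) xs"

definition directed_simplicial_complex :: "'v set \<Rightarrow> 'v list set \<Rightarrow> bool" where
  "directed_simplicial_complex V K \<longleftrightarrow>
    finite V \<and>
    (\<forall>xs\<in>K. xs \<noteq> [] \<and> set xs \<subseteq> V) \<and>
    (\<forall>xs\<in>K. length xs \<ge> 2 \<longrightarrow> (\<forall>i<length xs. omit i xs \<in> K)) \<and>
    (\<forall>v\<in>V. \<exists>xs\<in>K. v \<in> set xs)"

definition simplices :: "'v list set \<Rightarrow> nat \<Rightarrow> 'v list set" where
  "simplices K n = {xs \<in> K. length xs = Suc n}"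

definition one_dimensional :: "'v list set \<Rightarrow> bool" where
  "one_dimensional K \<longleftrightarrow> simplices K 1 \<noteq> {} \<and> simplices K 2 = {}"

definition chains :: "('r, 'm) ring_scheme \<Rightarrow> 'v list set \<Rightarrow> nat \<Rightarrow> ('r, 'v list \<Rightarrow> 'r) module" where
  "chains R K n = free_module R (simplices K n)"

abbreviation elementary_chain :: "('r, 'm) ring_scheme \<Rightarrow> 'v list \<Rightarrow> 'v list \<Rightarrow> 'r" where
  "elementary_chain R s \<equiv> basis_elem R s"

definition elementary_boundary ::
    "('r, 'm) ring_scheme \<Rightarrow> 'v list set \<Rightarrow> nat \<Rightarrow> 'v list \<Rightarrow> ('v list \<Rightarrow> 'r)" where
  "elementary_boundary R K n s =
    (\<Oplus>\<^bsub>chains R K (n - 1)\<^esub> i \<in> {0..n}.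
       ((\<ominus>\<^bsub>R\<^esub> \<one>\<^bsub>R\<^esub>) [^]\<^bsub>R\<^esub> i) \<odot>\<^bsub>chains R K (n - 1)\<^esub> elementary_chain R (omit i s))"

text \<open>
  The linear extension to all chains; a complex has only finitely many \<open>n\<close>-simplices, since its
  vertex set is finite. For \<open>n = 0\<close> the truncated \<open>n - 1\<close> is harmless, because only the
  zero function occurs as a value.
\<close>

definition boundary ::
    "('r, 'm) ring_scheme \<Rightarrow> 'v list set \<Rightarrow> nat \<Rightarrow> ('v list \<Rightarrow> 'r) \<Rightarrow> ('v list \<Rightarrow> 'r)" where
  "boundary R K n c =
    (if n = 0 then \<zero>\<^bsub>chains R K (n - 1)\<^esub>
     else \<Oplus>\<^bsub>chains R K (n - 1)\<^esub> s \<in> simplices K n.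
            c s \<odot>\<^bsub>chains R K (n - 1)\<^esub> elementary_boundary R K n s)"

definition cycles :: "('r, 'm) ring_scheme \<Rightarrow> 'v list set \<Rightarrow> nat \<Rightarrow> ('v list \<Rightarrow> 'r) set" where
  "cycles R K n = {c \<in> carrier (chains R K n). boundary R K n c = \<zero>\<^bsub>chains R K (n - 1)\<^esub>}"

definition boundaries :: "('r, 'm) ring_scheme \<Rightarrow> 'v list set \<Rightarrow> nat \<Rightarrow> ('v list \<Rightarrow> 'r) set" where
  "boundaries R K n = boundary R K (Suc n) ` carrier (chains R K (Suc n))"

definition cycle_module ::
    "('r, 'm) ring_scheme \<Rightarrow> 'v list set \<Rightarrow> nat \<Rightarrow> ('r, 'v list \<Rightarrow> 'r) module" where
  "cycle_module R K n = (chains R K n)\<lparr>carrier := cycles R K n\<rparr>"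

definition homology ::
    "('r, 'm) ring_scheme \<Rightarrow> 'v list set \<Rightarrow> nat \<Rightarrow> ('r, ('v list \<Rightarrow> 'r) set) module" where
  "homology R K n = FactModule (cycle_module R K n) (boundaries R K n)"

definition homology_class ::
    "('r, 'm) ring_scheme \<Rightarrow> 'v list set \<Rightarrow> nat \<Rightarrow> ('v list \<Rightarrow> 'r) \<Rightarrow> ('v list \<Rightarrow> 'r) set" where
  "homology_class R K n z = boundaries R K n +>\<^bsub>cycle_module R K n\<^esub> z"

definition directed_cycles ::
    "('r :: linordered_idom, 'm) ring_scheme \<Rightarrow> 'v list set \<Rightarrow> nat \<Rightarrow> ('v list \<Rightarrow> 'r) set" where
  "directed_cycles R K n =
    {z \<in> cycles R K n.
       \<exists>l. (\<forall>s\<in>simplices K n. l s \<in> carrier R \<and> \<zero>\<^bsub>R\<^esub> \<le> l s) \<and>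
           z = (\<Oplus>\<^bsub>chains R K n\<^esub> s \<in> simplices K n. l s \<odot>\<^bsub>chains R K n\<^esub> elementary_chain R s)}"

definition directed_homology ::
    "('r :: linordered_idom, 'm) ring_scheme \<Rightarrow> 'v list set \<Rightarrow> nat \<Rightarrow>
      ('r, ('v list \<Rightarrow> 'r) set) module" where
  "directed_homology R K n =
    (homology R K n)\<lparr>carrier :=
       generated_submodule R (homology R K n) (homology_class R K n ` directed_cycles R K n)\<rparr>"

abbreviation int_cring :: "int ring" where "int_cring \<equiv> ring_of_type_algebra"
abbreviation rat_cring :: "rat ring" where "rat_cring \<equiv> ring_of_type_algebra"
abbreviation real_cring :: "real ring" where "real_cring \<equiv> ring_of_type_algebra"

end

theory Submission
  imports Defs
begin

text \<open>
  Let \<open>s i = 1\<close> if \<open>e i\<close> runs from \<open>v i\<close> to \<open>v (i + 1)\<close> and \<open>s i = -1\<close> otherwise. The boundary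
  of \<open>e i\<close> is \<open>s i\<close> times \<open>[v (i + 1)] - [v i]\<close>, so for a chain \<open>c\<close> the numbers
  \<open>b i = s i * c (e i)\<close> can be read as a flow in the direction of increasing index: the coefficient
  of the boundary of \<open>c\<close> at a vertex is the flow entering it minus the flow leaving it. Hence
  \<open>c\<close> is a cycle if and only if \<open>b\<close> is constant (\<open>cycles_iff_flow_constant\<close>), and \<open>b 0\<close> is a linear
  coordinate identifying the cycles with \<open>R\<close>. There are no 2-simplices, so homology is the
  quotient of the cycles by \<open>0\<close>, where every class is a singleton; this gives the first claim.

  Over an ordered ring, a directed cycle is a cycle with nonnegative coefficients. If the
  orientations disagree, then some edge has coefficient \<open>a\<close> and another has \<open>-a\<close>, so only
  the zero cycle is directed and directed homology vanishes. If they agree, then the chain with all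
  coefficients \<open>1\<close> is a directed cycle, and every cycle is a multiple of it; so directed
  homology is all of homology.
\<close>

section \<open>Free modules\<close>

lemma free_module_simps [simp]:
  "\<zero>\<^bsub>free_module R S\<^esub> = (\<lambda>_. \<zero>\<^bsub>R\<^esub>)"
  "c \<oplus>\<^bsub>free_module R S\<^esub> d = (\<lambda>s. c s \<oplus>\<^bsub>R\<^esub> d s)"
  "a \<odot>\<^bsub>free_module R S\<^esub> c = (\<lambda>s. a \<otimes>\<^bsub>R\<^esub> c s)"
  by (simp_all add: free_module_def)

lemma free_module_carrier:
  "c \<in> carrier (free_module R S) \<longleftrightarrow>
     (\<forall>s\<in>S. c s \<in> carrier R) \<and> (\<forall>s. s \<notin> S \<longrightarrow> c s = \<zero>\<^bsub>R\<^esub>) \<and> finite {s. c s \<noteq> \<zero>\<^bsub>R\<^esub>}"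
  by (simp add: free_module_def)

context cring
begin

lemma free_module_apply_closed:
  "c \<in> carrier (free_module R S) \<Longrightarrow> c s \<in> carrier R"
  by (cases "s \<in> S") (auto simp: free_module_carrier)

lemma free_module_add_closed:
  assumes "c \<in> carrier (free_module R S)" "d \<in> carrier (free_module R S)"
  shows "(\<lambda>s. c s \<oplus> d s) \<in> carrier (free_module R S)"
proof -
  have "finite {s. c s \<oplus> d s \<noteq> \<zero>}"
    by (rule finite_subset[of _ "{s. c s \<noteq> \<zero>} \<union> {s. d s \<noteq> \<zero>}"])
       (use assms in \<open>auto simp: free_module_carrier\<close>)
  then show ?thesis using assms by (auto simp: free_module_carrier)
qed

lemma free_module_smult_closed:
  assumes "a \<in> carrier R" "c \<in> carrier (free_module R S)"
  shows "(\<lambda>s. a \<otimes> c s) \<in> carrier (free_module R S)"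
proof -
  have "finite {s. a \<otimes> c s \<noteq> \<zero>}"
    by (rule finite_subset[of _ "{s. c s \<noteq> \<zero>}"])
       (use assms in \<open>auto simp: free_module_carrier\<close>)
  then show ?thesis using assms by (auto simp: free_module_carrier)
qed

lemma free_module_is_module: "module R (free_module R S)"
proof (rule moduleI)
  show "abelian_group (free_module R S)"
  proof (rule abelian_groupI)
    fix c assume c: "c \<in> carrier (free_module R S)"
    \<comment> \<open>Scaling by \<open>-1\<close> gives the inverse, so closure follows from closure under scaling.\<close>
    have "(\<lambda>s. \<ominus> \<one> \<otimes> c s) \<in> carrier (free_module R S)"
      using c by (intro free_module_smult_closed) auto
    moreover have "(\<lambda>s. (\<ominus> \<one> \<otimes> c s) \<oplus> c s) = (\<lambda>_. \<zero>)"
      using c by (auto simp: free_module_apply_closed l_minus l_neg)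
    ultimately show "\<exists>d\<in>carrier (free_module R S). d \<oplus>\<^bsub>free_module R S\<^esub> c = \<zero>\<^bsub>free_module R S\<^esub>"
      by (auto intro!: bexI)
  qed (auto simp: free_module_add_closed free_module_apply_closed a_ac
         fun_eq_iff, auto simp: free_module_carrier)
qed (auto simp: is_cring free_module_smult_closed free_module_apply_closed fun_eq_iff
       l_distr r_distr m_assoc)

text \<open>
  Boundaries are sums taken inside a module of chains. Reading off one coefficient turns them
  into sums in the ring, where all later computations take place.
\<close>

lemma free_module_finsum_apply:
  assumes "f \<in> A \<rightarrow> carrier (free_module R S)"
  shows "(\<Oplus>\<^bsub>free_module R S\<^esub>i\<in>A. f i) t = (\<Oplus>i\<in>A. f i t)"
proof -
  interpret F: module R "free_module R S" by (rule free_module_is_module)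
  show ?thesis
  proof (cases "finite A")
    case True
    then show ?thesis using assms
    proof induction
      case (insert x A)
      then have "f \<in> A \<rightarrow> carrier (free_module R S)" "f x \<in> carrier (free_module R S)" by auto
      moreover from this have "(\<lambda>i. f i t) \<in> A \<rightarrow> carrier R" "f x t \<in> carrier R"
        by (auto intro: free_module_apply_closed)
      ultimately show ?case using insert by simp
    qed simp
  next
    case False
    then show ?thesis by (simp add: F.M.finsum_infinite finsum_infinite)
  qed
qed

lemma basis_elem_closed: "s \<in> S \<Longrightarrow> basis_elem R s \<in> carrier (free_module R S)"
  by (auto simp: free_module_carrier basis_elem_def)

lemma finsum_basis_elem:
  assumes "finite S" "c \<in> S \<rightarrow> carrier R"
  shows "(\<Oplus>\<^bsub>free_module R S\<^esub>s\<in>S. c s \<odot>\<^bsub>free_module R S\<^esub> basis_elem R s) =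
    (\<lambda>t. if t \<in> S then c t else \<zero>)"
proof
  fix t
  have "(\<lambda>s. c s \<odot>\<^bsub>free_module R S\<^esub> basis_elem R s) \<in> S \<rightarrow> carrier (free_module R S)"
    using assms by (auto intro!: free_module_smult_closed basis_elem_closed)
  then have "(\<Oplus>\<^bsub>free_module R S\<^esub>s\<in>S. c s \<odot>\<^bsub>free_module R S\<^esub> basis_elem R s) t =
      (\<Oplus>s\<in>S. c s \<otimes> basis_elem R s t)"
    by (subst free_module_finsum_apply) auto
  also have "\<dots> = (\<Oplus>s\<in>S. if t = s then c s else \<zero>)"
    using assms by (intro finsum_cong') (auto simp: basis_elem_def Pi_def)
  also have "\<dots> = (if t \<in> S then c t else \<zero>)"
  proof (cases "t \<in> S")
    case True then show ?thesis using finsum_singleton[of t S c] assms by simp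
  next
    case False
    then have "(\<Oplus>s\<in>S. if t = s then c s else \<zero>) = (\<Oplus>s\<in>S. \<zero>)"
      by (intro finsum_cong') auto
    with False show ?thesis by (simp add: finsum_zero)
  qed
  finally show "(\<Oplus>\<^bsub>free_module R S\<^esub>s\<in>S. c s \<odot>\<^bsub>free_module R S\<^esub> basis_elem R s) t =
    (if t \<in> S then c t else \<zero>)" .
qed

end

section \<open>Quotients by the zero submodule\<close>

text \<open>
  Cosets of \<open>0\<close> are singletons, so the quotient is a relabelled copy of the module.
\<close>

lemma (in module) FactModule_zero_simps:
  shows "carrier (FactModule M {\<zero>\<^bsub>M\<^esub>}) = (\<lambda>x. {x}) ` carrier M"
    and "\<zero>\<^bsub>FactModule M {\<zero>\<^bsub>M\<^esub>}\<^esub> = {\<zero>\<^bsub>M\<^esub>}"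
    and "{x} \<oplus>\<^bsub>FactModule M {\<zero>\<^bsub>M\<^esub>}\<^esub> {y} = {x \<oplus>\<^bsub>M\<^esub> y}"
    and "\<lbrakk>a \<in> carrier R; x \<in> carrier M\<rbrakk> \<Longrightarrow> a \<odot>\<^bsub>FactModule M {\<zero>\<^bsub>M\<^esub>}\<^esub> {x} = {a \<odot>\<^bsub>M\<^esub> x}"
  by (auto simp: FactModule_def A_RCOSETS_def' a_r_coset_def' set_add_def')

lemma (in module) FactModule_zero_is_module: "module R (FactModule M {\<zero>\<^bsub>M\<^esub>})"
proof (rule moduleI)
  show "abelian_group (FactModule M {\<zero>\<^bsub>M\<^esub>})"
  proof (rule abelian_groupI)
    fix A assume "A \<in> carrier (FactModule M {\<zero>\<^bsub>M\<^esub>})"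
    then obtain x where x: "A = {x}" "x \<in> carrier M" by (auto simp: FactModule_zero_simps)
    show "\<exists>B\<in>carrier (FactModule M {\<zero>\<^bsub>M\<^esub>}).
        B \<oplus>\<^bsub>FactModule M {\<zero>\<^bsub>M\<^esub>}\<^esub> A = \<zero>\<^bsub>FactModule M {\<zero>\<^bsub>M\<^esub>}\<^esub>"
      by (rule bexI[of _ "{\<ominus>\<^bsub>M\<^esub> x}"])
         (use x in \<open>auto simp: FactModule_zero_simps M.l_neg\<close>)
  qed (auto simp: FactModule_zero_simps M.a_ac)
qed (auto simp: FactModule_zero_simps R.is_cring smult_l_distr smult_r_distr smult_assoc1)

lemma (in module) FactModule_zero_isomorphic:
  "module_isomorphic R (FactModule M {\<zero>\<^bsub>M\<^esub>}) M"
  unfolding module_isomorphic_def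
proof (intro exI conjI)
  show "bij_betw the_elem (carrier (FactModule M {\<zero>\<^bsub>M\<^esub>})) (carrier M)"
    by (rule bij_betw_byWitness[where f' = "\<lambda>x. {x}"]) (auto simp: FactModule_zero_simps)
qed (auto simp: FactModule_zero_simps)

lemma module_isomorphic_trans:
  assumes "module_isomorphic R L M" "module_isomorphic R M N"
  shows "module_isomorphic R L N"
proof -
  from assms(1) obtain f where f: "bij_betw f (carrier L) (carrier M)"
      "\<forall>x\<in>carrier L. \<forall>y\<in>carrier L. f (x \<oplus>\<^bsub>L\<^esub> y) = f x \<oplus>\<^bsub>M\<^esub> f y"
      "\<forall>a\<in>carrier R. \<forall>x\<in>carrier L. f (a \<odot>\<^bsub>L\<^esub> x) = a \<odot>\<^bsub>M\<^esub> f x"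
    unfolding module_isomorphic_def by blast
  from assms(2) obtain g where g: "bij_betw g (carrier M) (carrier N)"
      "\<forall>x\<in>carrier M. \<forall>y\<in>carrier M. g (x \<oplus>\<^bsub>M\<^esub> y) = g x \<oplus>\<^bsub>N\<^esub> g y"
      "\<forall>a\<in>carrier R. \<forall>x\<in>carrier M. g (a \<odot>\<^bsub>M\<^esub> x) = a \<odot>\<^bsub>N\<^esub> g x"
    unfolding module_isomorphic_def by blast
  have "f x \<in> carrier M" if "x \<in> carrier L" for x using f(1) that by (auto simp: bij_betw_def)
  with f g show ?thesis
    unfolding module_isomorphic_def
    by (intro exI[of _ "g \<circ> f"]) (auto intro: bij_betw_trans)
qed

section \<open>Boundaries and cycles\<close>

lemma finite_simplices:
  assumes "directed_simplicial_complex V K"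
  shows "finite (simplices K n)"
proof (rule finite_subset)
  show "simplices K n \<subseteq> {xs. set xs \<subseteq> V \<and> length xs = Suc n}"
    using assms by (auto simp: simplices_def directed_simplicial_complex_def)
  show "finite {xs. set xs \<subseteq> V \<and> length xs = Suc n}"
    using assms by (auto simp: directed_simplicial_complex_def intro: finite_lists_length_eq)
qed

lemma omit_in_simplices:
  assumes "directed_simplicial_complex V K" "s \<in> simplices K (Suc n)" "i \<le> Suc n"
  shows "omit i s \<in> simplices K n"
  using assms by (auto simp: simplices_def directed_simplicial_complex_def omit_def)

context cring
begin

lemma elementary_boundary_summand_closed:
  assumes "directed_simplicial_complex V K" "s \<in> simplices K (Suc n)"
  shows "(\<lambda>i. ((\<ominus> \<one>) [^] i) \<odot>\<^bsub>chains R K n\<^esub> elementary_chain R (omit i s))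
    \<in> {0..Suc n} \<rightarrow> carrier (chains R K n)"
  unfolding chains_def
  using assms by (auto intro!: free_module_smult_closed basis_elem_closed omit_in_simplices)

lemma elementary_boundary_closed:
  assumes "directed_simplicial_complex V K" "s \<in> simplices K (Suc n)"
  shows "elementary_boundary R K (Suc n) s \<in> carrier (chains R K n)"
proof -
  interpret F: module R "chains R K n" unfolding chains_def by (rule free_module_is_module)
  show ?thesis
    using elementary_boundary_summand_closed[OF assms]
    unfolding elementary_boundary_def by simp
qed

lemma boundary_apply:
  assumes "directed_simplicial_complex V K" "c \<in> carrier (chains R K (Suc n))"
  shows "boundary R K (Suc n) c t =
    (\<Oplus>s\<in>simplices K (Suc n). c s \<otimes> elementary_boundary R K (Suc n) s t)"
proof -
  have "(\<lambda>s. c s \<odot>\<^bsub>chains R K n\<^esub> elementary_boundary R K (Suc n) s)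
      \<in> simplices K (Suc n) \<rightarrow> carrier (free_module R (simplices K n))"
    using assms elementary_boundary_closed[OF assms(1), of _ n]
    by (auto simp: chains_def free_module_apply_closed intro!: free_module_smult_closed)
  from free_module_finsum_apply[OF this, of t] show ?thesis
    by (simp add: boundary_def chains_def)
qed

text \<open>
  Both laws are checked coefficientwise, where the boundary is a finite sum whose terms are linear
  in the chain. They make the cycles, as a kernel, a submodule.
\<close>

lemma boundary_linear:
  assumes "directed_simplicial_complex V K"
    and "a \<in> carrier R" "c \<in> carrier (chains R K n)" "d \<in> carrier (chains R K n)"
  shows boundary_add:
      "boundary R K n (c \<oplus>\<^bsub>chains R K n\<^esub> d) t = boundary R K n c t \<oplus> boundary R K n d t"
    and boundary_smult:
      "boundary R K n (a \<odot>\<^bsub>chains R K n\<^esub> c) t = a \<otimes> boundary R K n c t"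
proof -
  have "boundary R K n (c \<oplus>\<^bsub>chains R K n\<^esub> d) t = boundary R K n c t \<oplus> boundary R K n d t \<and>
    boundary R K n (a \<odot>\<^bsub>chains R K n\<^esub> c) t = a \<otimes> boundary R K n c t"
  proof (cases n)
    case 0
    with assms show ?thesis by (simp add: boundary_def chains_def)
  next
    case (Suc m)
    let ?S = "simplices K (Suc m)" and ?E = "\<lambda>s. elementary_boundary R K (Suc m) s t"
    interpret F: module R "chains R K n" unfolding chains_def by (rule free_module_is_module)
    have fin: "finite ?S" using assms(1) by (rule finite_simplices)
    have E: "?E \<in> ?S \<rightarrow> carrier R"
      using elementary_boundary_closed[OF assms(1), of _ m]
      by (auto simp: chains_def intro: free_module_apply_closed)
    have cd: "c s \<in> carrier R" "d s \<in> carrier R" for s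
      using assms by (auto simp: chains_def intro: free_module_apply_closed)
    have "boundary R K n (c \<oplus>\<^bsub>chains R K n\<^esub> d) t = (\<Oplus>s\<in>?S. (c \<oplus>\<^bsub>chains R K n\<^esub> d) s \<otimes> ?E s)"
      using F.M.add.m_closed[OF assms(3,4)] unfolding Suc by (intro boundary_apply[OF assms(1)]) simp
    also have "\<dots> = (\<Oplus>s\<in>?S. c s \<otimes> ?E s \<oplus> d s \<otimes> ?E s)"
      using cd E by (intro finsum_cong') (auto simp: chains_def l_distr Pi_def)
    also have "\<dots> = boundary R K n c t \<oplus> boundary R K n d t"
      using cd E assms unfolding Suc
      by (simp add: boundary_apply[OF assms(1)] Suc) (intro finsum_addf; auto)
    finally have add: "boundary R K n (c \<oplus>\<^bsub>chains R K n\<^esub> d) t = boundary R K n c t \<oplus> boundary R K n d t" .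
    have "boundary R K n (a \<odot>\<^bsub>chains R K n\<^esub> c) t = (\<Oplus>s\<in>?S. (a \<odot>\<^bsub>chains R K n\<^esub> c) s \<otimes> ?E s)"
      using F.smult_closed[OF assms(2,3)] unfolding Suc by (intro boundary_apply[OF assms(1)]) simp
    also have "\<dots> = (\<Oplus>s\<in>?S. a \<otimes> (c s \<otimes> ?E s))"
      using cd E assms(2) by (intro finsum_cong') (auto simp: chains_def m_assoc Pi_def)
    also have "\<dots> = a \<otimes> boundary R K n c t"
      using cd E assms fin unfolding Suc
      by (simp add: boundary_apply[OF assms(1)] Suc) (intro finsum_rdistr[symmetric]; auto)
    finally show ?thesis using add by blast
  qed
  then show "boundary R K n (c \<oplus>\<^bsub>chains R K n\<^esub> d) t = boundary R K n c t \<oplus> boundary R K n d t"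
    "boundary R K n (a \<odot>\<^bsub>chains R K n\<^esub> c) t = a \<otimes> boundary R K n c t" by blast+
qed

lemma cycles_iff:
  "c \<in> cycles R K n \<longleftrightarrow> c \<in> carrier (chains R K n) \<and> (\<forall>t. boundary R K n c t = \<zero>)"
  by (auto simp: cycles_def chains_def)

lemma cycles_submodule:
  assumes "directed_simplicial_complex V K"
  shows "submodule (cycles R K n) R (chains R K n)"
proof -
  interpret F: module R "chains R K n" unfolding chains_def by (rule free_module_is_module)
  have smult: "a \<odot>\<^bsub>chains R K n\<^esub> c \<in> cycles R K n" if "a \<in> carrier R" "c \<in> cycles R K n" for a c
    using that boundary_smult[OF assms, of a c n c] by (auto simp: cycles_iff)
  have chain: "c \<in> carrier (chains R K n)" if "c \<in> cycles R K n" for c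
    using that by (simp add: cycles_iff)
  show ?thesis
  proof (rule F.submoduleI)
    show "\<zero>\<^bsub>chains R K n\<^esub> \<in> cycles R K n"
    proof (cases n)
      case (Suc m)
      have "boundary R K (Suc m) \<zero>\<^bsub>chains R K (Suc m)\<^esub> t = \<zero>" for t
      proof -
        have "(\<Oplus>s\<in>simplices K (Suc m). \<zero>\<^bsub>chains R K (Suc m)\<^esub> s \<otimes> elementary_boundary R K (Suc m) s t)
            = (\<Oplus>s\<in>simplices K (Suc m). \<zero>)"
          using elementary_boundary_closed[OF assms, of _ m]
          by (intro finsum_cong') (auto simp: chains_def free_module_apply_closed[of _ "simplices K m"])
        then show ?thesis
          using boundary_apply[OF assms, of "\<zero>\<^bsub>chains R K (Suc m)\<^esub>" m t] F.M.zero_closed Suc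
          by (simp add: finsum_zero)
      qed
      with Suc F.M.zero_closed show ?thesis by (simp add: cycles_iff)
    qed (use F.M.zero_closed in \<open>simp add: cycles_def boundary_def\<close>)
    fix c d assume "c \<in> cycles R K n" "d \<in> cycles R K n"
    then show "c \<oplus>\<^bsub>chains R K n\<^esub> d \<in> cycles R K n"
      using boundary_add[OF assms, of \<zero> c n d] by (auto simp: cycles_iff)
  next
    fix c assume "c \<in> cycles R K n"
    then show "\<ominus>\<^bsub>chains R K n\<^esub> c \<in> cycles R K n"
      using smult[of "\<ominus> \<one>" c] chain by (simp add: F.smult_l_minus)
  qed (use smult chain in auto)
qed

lemma cycle_module_is_module:
  assumes "directed_simplicial_complex V K"
  shows "module R (cycle_module R K n)"
  unfolding cycle_module_def
  using cycles_submodule[OF assms] free_module_is_module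
  by (auto simp: chains_def intro: submodule.submodule_is_module)

lemma cycle_module_simps [simp]:
  "carrier (cycle_module R K n) = cycles R K n"
  "\<zero>\<^bsub>cycle_module R K n\<^esub> = (\<lambda>_. \<zero>)"
  "c \<oplus>\<^bsub>cycle_module R K n\<^esub> d = (\<lambda>s. c s \<oplus> d s)"
  "a \<odot>\<^bsub>cycle_module R K n\<^esub> c = (\<lambda>s. a \<otimes> c s)"
  by (simp_all add: cycle_module_def chains_def)

text \<open>
  In the top dimension the only boundary is an empty sum, and homology consists of the cycles
  themselves.
\<close>

lemma boundaries_top:
  assumes "simplices K (Suc n) = {}"
  shows "boundaries R K n = {\<zero>\<^bsub>cycle_module R K n\<^esub>}"
proof -
  interpret F: module R "chains R K n" unfolding chains_def by (rule free_module_is_module)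
  interpret G: module R "chains R K (Suc n)" unfolding chains_def by (rule free_module_is_module)
  have "boundary R K (Suc n) c = \<zero>\<^bsub>chains R K n\<^esub>" for c
    by (simp add: boundary_def assms)
  then show ?thesis
    using G.M.zero_closed unfolding boundaries_def by (auto simp: chains_def)
qed

lemma homology_top:
  assumes "simplices K (Suc n) = {}"
  shows "homology R K n = FactModule (cycle_module R K n) {\<zero>\<^bsub>cycle_module R K n\<^esub>}"
  unfolding homology_def boundaries_top[OF assms] ..

lemma homology_class_top:
  assumes "directed_simplicial_complex V K" "simplices K (Suc n) = {}" "z \<in> cycles R K n"
  shows "homology_class R K n z = {z}"
proof -
  interpret Z: module R "cycle_module R K n" by (rule cycle_module_is_module[OF assms(1)])
  show ?thesis
    using Z.M.l_zero[of z] assms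
    unfolding homology_class_def boundaries_top[OF assms(2)] by (simp add: a_r_coset_def')
qed

end

text \<open>
  The elementary chains form a basis, so the nonnegative coefficients in a representation of
  \<open>z\<close> must be the values of \<open>z\<close>.
\<close>

lemma directed_cycles_iff:
  fixes R0 :: "'r::linordered_idom ring"
  defines "R0 \<equiv> ring_of_type_algebra"
  assumes "directed_simplicial_complex V K"
  shows "z \<in> directed_cycles R0 K n \<longleftrightarrow> z \<in> cycles R0 K n \<and> (\<forall>s\<in>simplices K n. 0 \<le> z s)"
proof -
  interpret cring R0 unfolding R0_def by rule
  have R0: "carrier R0 = UNIV" "\<zero>\<^bsub>R0\<^esub> = 0" by (simp_all add: R0_def ring_of_type_algebra_def)
  have sum: "(\<Oplus>\<^bsub>chains R0 K n\<^esub>s\<in>simplices K n. l s \<odot>\<^bsub>chains R0 K n\<^esub> elementary_chain R0 s) =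
      (\<lambda>t. if t \<in> simplices K n then l t else 0)" for l
    using finsum_basis_elem[OF finite_simplices[OF assms(2)], of l n]
    by (simp add: chains_def R0 cong: if_cong)
  have "z = (\<lambda>t. if t \<in> simplices K n then z t else 0)" if "z \<in> cycles R0 K n"
    using that by (auto simp: cycles_def chains_def free_module_carrier R0)
  then show ?thesis unfolding directed_cycles_def sum by (auto simp: R0)
qed

section \<open>Homology of a polygon\<close>

locale polygon =
  fixes V :: "'v set" and K :: "'v list set" and v :: "nat \<Rightarrow> 'v" and e :: "nat \<Rightarrow> 'v list"
    and n :: nat
  assumes complex: "directed_simplicial_complex V K"
    and no_triangles: "simplices K (Suc 1) = {}"
    and n_pos: "n \<ge> 1"
    and v_inj: "inj_on v {0..n}"
    and v_closed: "v (Suc n) = v 0"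
    and edges: "simplices K 1 = e ` {0..n}"
    and e_inj: "inj_on e {0..n}"
    and e_ends: "i \<in> {0..n} \<Longrightarrow> e i = [v i, v (Suc i)] \<or> e i = [v (Suc i), v i]"
begin

\<comment> \<open>Keeps the dimension in the form \<open>1\<close>, so that rewrite rules stated for it still match.\<close>
declare One_nat_def [simp del]

definition forward :: "nat \<Rightarrow> bool" where
  "forward i \<longleftrightarrow> e i = [v i, v (Suc i)]"

text \<open>
  Multiplication by the sign of an edge. It is an involution, so it also recovers a coefficient
  from the flow along the edge.
\<close>

abbreviation orient :: "('r, 'm) ring_scheme \<Rightarrow> nat \<Rightarrow> 'r \<Rightarrow> 'r" where
  "orient R i a \<equiv> (if forward i then a else \<ominus>\<^bsub>R\<^esub> a)"

text \<open>
  The index of the edge that precedes \<open>v j\<close> in cyclic order; only at \<open>v 0\<close> does it wrap around.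
\<close>

definition prev :: "nat \<Rightarrow> nat" where
  "prev j = (if j = 0 then n else j - 1)"

lemma v_Suc_eq_iff:
  assumes "i \<le> n" "j \<le> n"
  shows "v (Suc i) = v j \<longleftrightarrow> i = prev j"
proof (cases "i = n")
  case True
  then show ?thesis
    using v_closed inj_onD[OF v_inj, of 0 j] assms by (auto simp: prev_def)
next
  case False
  then show ?thesis
    using inj_onD[OF v_inj, of "Suc i" j] assms by (auto simp: prev_def)
qed

lemma v_eq_iff: "i \<le> n \<Longrightarrow> j \<le> n \<Longrightarrow> v i = v j \<longleftrightarrow> i = j"
  using inj_onD[OF v_inj, of i j] by auto

lemma prev_le: "j \<le> n \<Longrightarrow> prev j \<le> n"
  by (auto simp: prev_def)

lemma constant_if_prev_equal:
  assumes "\<And>j. j \<le> n \<Longrightarrow> b (prev j) = b j" "i \<le> n"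
  shows "b i = b 0"
  using assms(2)
proof (induction i)
  case (Suc i)
  then show ?case using assms(1)[of "Suc i"] by (simp add: prev_def)
qed simp

lemma elementary_boundary_edge:
  assumes "cring R" "i \<le> n"
  shows "elementary_boundary R K 1 (e i) t =
    orient R i (basis_elem R [v (Suc i)] t \<ominus>\<^bsub>R\<^esub> basis_elem R [v i] t)"
proof -
  interpret cring R by fact
  have s: "e i \<in> simplices K (Suc 0)" using edges assms by (auto simp: One_nat_def)
  have c: "basis_elem R x t \<in> carrier R" for x :: "'v list" by (simp add: basis_elem_def)
  have closed: "(\<lambda>i'. ((\<ominus>\<^bsub>R\<^esub> \<one>\<^bsub>R\<^esub>) [^]\<^bsub>R\<^esub> i') \<odot>\<^bsub>chains R K 0\<^esub> elementary_chain R (omit i' (e i)))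
     \<in> {0..Suc 0} \<rightarrow> carrier (free_module R (simplices K 0))"
    using elementary_boundary_summand_closed[OF complex s] by (simp add: chains_def)
  have "elementary_boundary R K 1 (e i) t =
     (\<Oplus>\<^bsub>R\<^esub>j\<in>{0..Suc 0}. (\<ominus>\<^bsub>R\<^esub> \<one>\<^bsub>R\<^esub>) [^]\<^bsub>R\<^esub> j \<otimes>\<^bsub>R\<^esub> basis_elem R (omit j (e i)) t)"
    using free_module_finsum_apply[OF closed, of t]
    by (simp add: elementary_boundary_def chains_def One_nat_def)
  also have "\<dots> = basis_elem R (omit 0 (e i)) t \<ominus>\<^bsub>R\<^esub> basis_elem R (omit (Suc 0) (e i)) t"
    using c by (simp add: atLeast0_atMost_Suc l_minus minus_eq a_comm)
  finally show ?thesis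
    using e_ends[of i] assms c by (auto simp: forward_def omit_def minus_eq minus_add a_comm)
qed

lemma boundary_as_sum_over_edges:
  assumes "cring R" "c \<in> carrier (chains R K 1)"
  shows "boundary R K 1 c t = (\<Oplus>\<^bsub>R\<^esub>i\<in>{0..n}. c (e i) \<otimes>\<^bsub>R\<^esub>
    orient R i (basis_elem R [v (Suc i)] t \<ominus>\<^bsub>R\<^esub> basis_elem R [v i] t))"
proof -
  interpret cring R by fact
  have c: "c s \<in> carrier R" for s
    using assms by (auto simp: chains_def free_module_apply_closed)
  have b: "basis_elem R x t \<in> carrier R" for x :: "'v list" by (simp add: basis_elem_def)
  have "boundary R K 1 c t =
      (\<Oplus>\<^bsub>R\<^esub>s\<in>e ` {0..n}. c s \<otimes>\<^bsub>R\<^esub> elementary_boundary R K 1 s t)"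
    using boundary_apply[OF complex, of c 0] assms edges by (simp add: One_nat_def)
  also have "\<dots> = (\<Oplus>\<^bsub>R\<^esub>i\<in>{0..n}. c (e i) \<otimes>\<^bsub>R\<^esub> elementary_boundary R K 1 (e i) t)"
    using e_inj b c assms(1)
    by (intro finsum_reindex) (auto simp: elementary_boundary_edge)
  also have "\<dots> = (\<Oplus>\<^bsub>R\<^esub>i\<in>{0..n}. c (e i) \<otimes>\<^bsub>R\<^esub>
    orient R i (basis_elem R [v (Suc i)] t \<ominus>\<^bsub>R\<^esub> basis_elem R [v i] t))"
    using b c assms(1)
    by (intro finsum_cong') (auto simp: elementary_boundary_edge)
  finally show ?thesis .
qed

text \<open>
  Only the two edges adjacent to \<open>v j\<close> contribute, one by its end and one by its start with
  respect to the cyclic order.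
\<close>

lemma boundary_at_vertex:
  assumes "cring R" "c \<in> carrier (chains R K 1)" "j \<le> n"
  shows "boundary R K 1 c [v j] =
    orient R (prev j) (c (e (prev j))) \<ominus>\<^bsub>R\<^esub> orient R j (c (e j))"
proof -
  interpret cring R by fact
  let ?b = "\<lambda>i. orient R i (c (e i))"
  have c: "c s \<in> carrier R" for s
    using assms by (auto simp: chains_def free_module_apply_closed)
  have "boundary R K 1 c [v j] = (\<Oplus>\<^bsub>R\<^esub>i\<in>{0..n}. (if prev j = i then ?b i else \<zero>\<^bsub>R\<^esub>) \<oplus>\<^bsub>R\<^esub>
      (if j = i then \<ominus>\<^bsub>R\<^esub> ?b i else \<zero>\<^bsub>R\<^esub>))"
    unfolding boundary_as_sum_over_edges[OF assms(1,2)] using c assms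
    by (intro finsum_cong')
      (auto simp: basis_elem_def v_Suc_eq_iff v_eq_iff
        eq_commute[of "v j"] minus_eq r_minus r_neg l_neg minus_add)
  \<comment> \<open>Each part has at most one nonzero term. Splitting the sum avoids asking whether the two
     edges differ.\<close>
  also have "\<dots> = (\<Oplus>\<^bsub>R\<^esub>i\<in>{0..n}. if prev j = i then ?b i else \<zero>\<^bsub>R\<^esub>) \<oplus>\<^bsub>R\<^esub>
      (\<Oplus>\<^bsub>R\<^esub>i\<in>{0..n}. if j = i then \<ominus>\<^bsub>R\<^esub> ?b i else \<zero>\<^bsub>R\<^esub>)"
    using c by (intro finsum_addf) auto
  also have "\<dots> = ?b (prev j) \<oplus>\<^bsub>R\<^esub> \<ominus>\<^bsub>R\<^esub> ?b j"
    using c assms prev_le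
    by (intro arg_cong2[where f = "add R"] finsum_singleton) auto
  finally show ?thesis by (simp add: minus_eq)
qed

text \<open>
  Conservation of flow: at every vertex the incoming flow equals the outgoing flow, and following
  the polygon from \<open>v 0\<close> propagates the equality to all edges.
\<close>

lemma cycles_iff_flow_constant:
  assumes "cring R" "c \<in> carrier (chains R K 1)"
  shows "c \<in> cycles R K 1 \<longleftrightarrow> (\<forall>i\<le>n. orient R i (c (e i)) = orient R 0 (c (e 0)))"
proof -
  interpret cring R by fact
  let ?b = "\<lambda>i. orient R i (c (e i))"
  have c: "c s \<in> carrier R" for s
    using assms by (auto simp: chains_def free_module_apply_closed)
  have at_vertex: "boundary R K 1 c [v j] = \<zero>\<^bsub>R\<^esub> \<longleftrightarrow> ?b (prev j) = ?b j" if "j \<le> n" for j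
    using boundary_at_vertex[OF assms that] c r_right_minus_eq[of "?b (prev j)" "?b j"] by auto
  have off_vertex: "boundary R K 1 c t = \<zero>\<^bsub>R\<^esub>" if t: "\<And>j. j \<le> n \<Longrightarrow> t \<noteq> [v j]" for t
  proof -
    have "t \<noteq> [v (Suc i)]" if "i \<le> n" for i
      using t[of 0] t[of "Suc i"] v_closed that by (cases "i = n") auto
    with t have "boundary R K 1 c t = (\<Oplus>\<^bsub>R\<^esub>i\<in>{0..n}. \<zero>\<^bsub>R\<^esub>)"
      unfolding boundary_as_sum_over_edges[OF assms] using c
      by (intro finsum_cong') (auto simp: basis_elem_def minus_eq)
    then show ?thesis by (simp add: finsum_zero)
  qed
  have "c \<in> cycles R K 1 \<longleftrightarrow> (\<forall>j\<le>n. ?b (prev j) = ?b j)"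
  proof
    assume "c \<in> cycles R K 1"
    then show "\<forall>j\<le>n. ?b (prev j) = ?b j" using at_vertex cycles_iff by blast
  next
    assume "\<forall>j\<le>n. ?b (prev j) = ?b j"
    then have "boundary R K 1 c t = \<zero>\<^bsub>R\<^esub>" for t
      using at_vertex off_vertex[of t] by (cases "\<exists>j\<le>n. t = [v j]") auto
    then show "c \<in> cycles R K 1" using assms(2) cycles_iff by blast
  qed
  also have "\<dots> \<longleftrightarrow> (\<forall>i\<le>n. ?b i = ?b 0)"
  proof
    assume "\<forall>j\<le>n. ?b (prev j) = ?b j"
    then show "\<forall>i\<le>n. ?b i = ?b 0" using constant_if_prev_equal[of ?b] by blast
  next
    assume const: "\<forall>i\<le>n. ?b i = ?b 0"
    then show "\<forall>j\<le>n. ?b (prev j) = ?b j"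
    proof (intro allI impI)
      fix j assume j: "j \<le> n"
      have "?b (prev j) = ?b 0" by (rule const[rule_format, OF prev_le[OF j]])
      also have "\<dots> = ?b j" by (rule const[rule_format, OF j, symmetric])
      finally show "?b (prev j) = ?b j" .
    qed
  qed
  finally show ?thesis .
qed

text \<open>
  The constant flow is determined by its value on one edge.
\<close>

lemma cycle_eqI:
  assumes "cring R" "c \<in> cycles R K 1" "d \<in> cycles R K 1" "c (e 0) = d (e 0)"
  shows "c = d"
proof -
  interpret cring R by fact
  have chain: "c \<in> carrier (chains R K 1)" "d \<in> carrier (chains R K 1)"
    using assms by (simp_all add: cycles_iff)
  then have closed: "c s \<in> carrier R" "d s \<in> carrier R" for s
    by (auto simp: chains_def free_module_apply_closed)
  have "c (e i) = d (e i)" if "i \<le> n" for i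
  proof -
    have "orient R i (c (e i)) = orient R i (d (e i))"
      using cycles_iff_flow_constant[OF assms(1)] chain assms that by metis
    then show ?thesis using closed minus_minus by (metis (full_types))
  qed
  then have "c s = d s" if "s \<in> e ` {0..n}" for s using that by auto
  moreover have "c s = d s" if "s \<notin> e ` {0..n}" for s
    using chain edges that by (simp add: chains_def free_module_carrier)
  ultimately show ?thesis by blast
qed

text \<open>
  The chain with constant flow \<open>a\<close>. Comparing a tuple with all pairs \<open>(v i, v (i + 1))\<close> would not
  give its direction: when \<open>n = 1\<close>, the edge \<open>e 0 = (v 1, v 0)\<close> is backward although it is the pair
  for \<open>i = 1\<close>. Hence the sign is looked up by the index of the edge.
\<close>

definition flow :: "('r, 'm) ring_scheme \<Rightarrow> 'r \<Rightarrow> 'v list \<Rightarrow> 'r" where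
  "flow R a s = (if s \<in> e ` {0..n} then orient R (inv_into {0..n} e s) a else \<zero>\<^bsub>R\<^esub>)"

lemma flow_edge: "i \<le> n \<Longrightarrow> flow R a (e i) = orient R i a"
  using e_inj by (simp add: flow_def)

lemma flow_cycle:
  assumes "cring R" "a \<in> carrier R"
  shows "flow R a \<in> cycles R K 1"
proof -
  interpret cring R by fact
  have "finite {s. flow R a s \<noteq> \<zero>\<^bsub>R\<^esub>}"
    by (rule finite_subset[of _ "e ` {0..n}"]) (auto simp: flow_def)
  then have "flow R a \<in> carrier (chains R K 1)"
    using edges assms by (auto simp: chains_def free_module_carrier flow_def)
  then show ?thesis
    using cycles_iff_flow_constant[OF assms(1)] assms(2) by (simp add: flow_edge)
qed

lemma cycle_module_isomorphic:
  assumes "cring R"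
  shows "module_isomorphic R (cycle_module R K 1) (regular_module R)"
proof -
  interpret cring R by fact
  let ?h = "\<lambda>c. orient R 0 (c (e 0))"
  have closed: "c s \<in> carrier R" if "c \<in> cycles R K 1" for c s
    using that by (auto simp: cycles_iff chains_def free_module_apply_closed)
  have "bij_betw ?h (cycles R K 1) (carrier R)"
  proof (rule bij_betw_byWitness[where f' = "flow R"])
    show "\<forall>c\<in>cycles R K 1. flow R (?h c) = c"
      using closed by (auto intro!: cycle_eqI[OF assms] flow_cycle[OF assms] simp: flow_edge)
    show "\<forall>a\<in>carrier R. ?h (flow R a) = a" by (simp add: flow_edge)
  qed (use closed flow_cycle[OF assms] in auto)
  then show ?thesis
    unfolding module_isomorphic_def
    by (intro exI[of _ ?h]) (auto simp: closed regular_module_def minus_add r_minus)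
qed

lemma homology_isomorphic:
  assumes "cring R"
  shows "module_isomorphic R (homology R K 1) (regular_module R)"
proof -
  interpret cring R by fact
  interpret Z: module R "cycle_module R K 1" by (rule cycle_module_is_module[OF complex])
  show ?thesis
    using Z.FactModule_zero_isomorphic cycle_module_isomorphic[OF assms]
    unfolding homology_top[OF no_triangles] by (rule module_isomorphic_trans)
qed

abbreviation coherent :: bool where
  "coherent \<equiv> (\<forall>i\<in>{0..n}. forward i) \<or> (\<forall>i\<in>{0..n}. e i = [v (Suc i), v i])"

text \<open>
  An edge cannot have both directions: its two ends are distinct because there are at least
  two vertices.
\<close>

lemma coherent_iff: "coherent \<longleftrightarrow> (\<forall>i\<le>n. forward i = forward 0)"
proof -
  have "e i = [v (Suc i), v i] \<longleftrightarrow> \<not> forward i" if "i \<le> n" for i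
    using e_ends[of i] v_eq_iff[of i 0] v_eq_iff[of i "Suc i"] v_closed n_pos that
    by (cases "i = n") (auto simp: forward_def)
  then have "coherent \<longleftrightarrow> (\<forall>i\<le>n. forward i) \<or> (\<forall>i\<le>n. \<not> forward i)"
    by (simp add: Ball_def)
  also have "\<dots> \<longleftrightarrow> (\<forall>i\<le>n. forward i = forward 0)" by blast
  finally show ?thesis .
qed

section \<open>Directed homology of a polygon\<close>

text \<open>
  An edge directed differently from \<open>e 0\<close> carries the negative of the coefficient of \<open>e 0\<close>. As both
  are nonnegative, both vanish, and with one coefficient the whole cycle vanishes.
\<close>

lemma directed_cycles_incoherent:
  fixes R0 :: "'r::linordered_idom ring"
  defines "R0 \<equiv> ring_of_type_algebra"
  assumes "\<not> coherent"
  shows "directed_cycles R0 K 1 = {\<lambda>_. 0}"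
proof -
  interpret cring R0 unfolding R0_def by rule
  interpret Z: module R0 "cycle_module R0 K 1" by (rule cycle_module_is_module[OF complex])
  have zero: "\<zero>\<^bsub>R0\<^esub> = 0" by (simp add: R0_def ring_of_type_algebra_def)
  have zero_cycle: "(\<lambda>_. 0) \<in> cycles R0 K 1" using Z.M.zero_closed by (simp add: zero)
  have minus: "\<ominus>\<^bsub>R0\<^esub> a = - a" for a
    by (rule minus_equality) (simp_all add: R0_def ring_of_type_algebra_def)
  obtain i where i: "i \<le> n" "forward i \<noteq> forward 0" using assms(2) coherent_iff by blast
  have "z = (\<lambda>_. 0)" if "z \<in> cycles R0 K 1" "\<forall>s\<in>simplices K 1. 0 \<le> z s" for z
  proof (rule cycle_eqI)
    have "orient R0 i (z (e i)) = orient R0 0 (z (e 0))"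
      using cycles_iff_flow_constant[of R0 z] is_cring that(1) i(1) cycles_iff by blast
    moreover have "0 \<le> z (e i)" "0 \<le> z (e 0)" using that(2) edges i(1) by auto
    ultimately show "z (e 0) = 0" using i(2) by (auto simp: minus split: if_splits)
  qed (use that(1) zero_cycle is_cring in auto)
  moreover have "z \<in> directed_cycles R0 K 1 \<longleftrightarrow>
      z \<in> cycles R0 K 1 \<and> (\<forall>s\<in>simplices K 1. 0 \<le> z s)" for z
    unfolding R0_def by (rule directed_cycles_iff[OF complex])
  ultimately show ?thesis using zero_cycle by blast
qed

lemma directed_homology_incoherent:
  fixes R0 :: "'r::linordered_idom ring"
  defines "R0 \<equiv> ring_of_type_algebra"
  assumes "\<not> coherent"
  shows "\<not> nontrivial_module (directed_homology R0 K 1)"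
proof -
  interpret cring R0 unfolding R0_def by rule
  interpret Z: module R0 "cycle_module R0 K 1" by (rule cycle_module_is_module[OF complex])
  interpret H: module R0 "homology R0 K 1"
    unfolding homology_top[OF no_triangles] by (rule Z.FactModule_zero_is_module)
  note H_simps = Z.FactModule_zero_simps[folded homology_top[OF no_triangles]]
  let ?o = "\<zero>\<^bsub>homology R0 K 1\<^esub>"
  have zero: "\<zero>\<^bsub>R0\<^esub> = 0" by (simp add: R0_def ring_of_type_algebra_def)
  have "(\<lambda>_. 0) \<in> cycles R0 K 1" using Z.M.zero_closed by (simp add: zero)
  then have gens: "homology_class R0 K 1 ` directed_cycles R0 K 1 = {?o}"
    using directed_cycles_incoherent[OF assms(2), where 'r = 'r, folded R0_def]
      homology_class_top[OF complex no_triangles]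
    by (simp add: H_simps zero)
  have "submodule {?o} R0 (homology R0 K 1)"
    by (rule H.submoduleI) auto
  then have "generated_submodule R0 (homology R0 K 1) {?o} = {?o}"
    by (auto simp: generated_submodule_def)
  then show ?thesis by (simp add: nontrivial_module_def directed_homology_def gens)
qed

text \<open>
  The class of the all-one cycle generates. This chain is directed whichever way the polygon is
  traversed, so the two coherent orientations need no separate treatment.
\<close>

lemma directed_homology_coherent:
  fixes R0 :: "'r::linordered_idom ring"
  defines "R0 \<equiv> ring_of_type_algebra"
  assumes coherent
  shows "directed_homology R0 K 1 = homology R0 K 1"
    and "nontrivial_module (homology R0 K 1)"
proof -
  interpret cring R0 unfolding R0_def by rule
  interpret Z: module R0 "cycle_module R0 K 1" by (rule cycle_module_is_module[OF complex])
  interpret H: module R0 "homology R0 K 1"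
    unfolding homology_top[OF no_triangles] by (rule Z.FactModule_zero_is_module)
  note H_simps = Z.FactModule_zero_simps[folded homology_top[OF no_triangles]]
  have R0: "carrier R0 = UNIV" "\<zero>\<^bsub>R0\<^esub> = 0" "\<one>\<^bsub>R0\<^esub> = 1" "x \<otimes>\<^bsub>R0\<^esub> y = x * y" for x y
    by (simp_all add: R0_def ring_of_type_algebra_def)
  have minus: "\<ominus>\<^bsub>R0\<^esub> a = - a" for a
    by (rule minus_equality) (simp_all add: R0_def ring_of_type_algebra_def)
  \<comment> \<open>The all-one cycle: its flow is the common sign of the edges.\<close>
  define u where "u = flow R0 (orient R0 0 1)"
  have u_cycle: "u \<in> cycles R0 K 1"
    unfolding u_def by (rule flow_cycle[OF is_cring]) (simp add: R0)
  have u_edge: "u (e i) = 1" if "i \<le> n" for i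
  proof -
    have "forward i = forward 0" using assms(2) that coherent_iff by blast
    then show ?thesis using that by (simp add: u_def flow_edge minus)
  qed
  have "u \<in> directed_cycles R0 K 1"
    using directed_cycles_iff[OF complex, of u 1, folded R0_def] u_cycle u_edge edges by auto
  then have u_gen: "{u} \<in> homology_class R0 K 1 ` directed_cycles R0 K 1"
    using homology_class_top[OF complex no_triangles u_cycle] by force
  have multiple: "c = (\<lambda>s. c (e 0) * u s)" if "c \<in> cycles R0 K 1" for c
  proof (rule cycle_eqI[OF is_cring that])
    show "(\<lambda>s. c (e 0) * u s) \<in> cycles R0 K 1"
      using Z.smult_closed[of "c (e 0)" u] u_cycle by (simp add: R0)
  qed (simp add: u_edge)
  have "generated_submodule R0 (homology R0 K 1) (homology_class R0 K 1 ` directed_cycles R0 K 1)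
      = carrier (homology R0 K 1)" (is "?G = _")
  proof
    have "homology_class R0 K 1 ` directed_cycles R0 K 1 \<subseteq> carrier (homology R0 K 1)"
      using homology_class_top[OF complex no_triangles]
      by (auto simp: directed_cycles_def H_simps)
    then show "?G \<subseteq> carrier (homology R0 K 1)"
      using H.carrier_is_submodule by (auto simp: generated_submodule_def)
    show "carrier (homology R0 K 1) \<subseteq> ?G"
    proof
      fix A assume "A \<in> carrier (homology R0 K 1)"
      then obtain c where c: "A = {c}" "c \<in> cycles R0 K 1" by (auto simp: H_simps)
      have "A = c (e 0) \<odot>\<^bsub>homology R0 K 1\<^esub> {u}"
        using c multiple[OF c(2)] u_cycle by (simp add: H_simps R0)
      then show "A \<in> ?G"
        using u_gen by (auto simp: generated_submodule_def R0 intro!: submodule.smult_closed)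
    qed
  qed
  then show "directed_homology R0 K 1 = homology R0 K 1"
    by (simp add: directed_homology_def)
  have "u \<noteq> (\<lambda>_. 0)" using u_edge[of 0] by auto
  then show "nontrivial_module (homology R0 K 1)"
    using u_cycle by (auto simp: nontrivial_module_def H_simps R0)
qed

lemma directed_homology_dichotomy:
  fixes R0 :: "'r::linordered_idom ring"
  defines "R0 \<equiv> ring_of_type_algebra"
  shows "(nontrivial_module (directed_homology R0 K 1) \<longleftrightarrow> coherent) \<and>
    (coherent \<longrightarrow> module_isomorphic R0 (directed_homology R0 K 1) (regular_module R0))"
proof -
  have "cring R0" unfolding R0_def by rule
  note iso = homology_isomorphic[OF this]
  show ?thesis
  proof (cases coherent)
    case True
    from directed_homology_coherent[OF this, where 'r = 'r, folded R0_def] iso True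
    show ?thesis by simp
  next
    case False
    with directed_homology_incoherent[OF this, where 'r = 'r, folded R0_def]
    show ?thesis by blast
  qed
qed

end

theorem proposition3p24:
  fixes R :: "('r, 'm) ring_scheme"
    and V :: "'v set" and K :: "'v list set"
    and v :: "nat \<Rightarrow> 'v" and e :: "nat \<Rightarrow> 'v list" and n :: nat
  assumes "cring R"
    and "directed_simplicial_complex V K"
    and "one_dimensional K"
    and "n \<ge> 1"
    and "V = v ` {0..n}" and "inj_on v {0..n}"
    and "v (n + 1) = v 0"
    and "simplices K 1 = e ` {0..n}" and "inj_on e {0..n}"
    and "\<forall>i\<in>{0..n}. e i = [v i, v (i + 1)] \<or> e i = [v (i + 1), v i]"
  shows "module_isomorphic R (homology R K 1) (regular_module R) \<and>
    (let coherent = (\<forall>i\<in>{0..n}. e i = [v i, v (i + 1)]) \<or> (\<forall>i\<in>{0..n}. e i = [v (i + 1), v i]) in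
      ((nontrivial_module (directed_homology int_cring K 1) \<longleftrightarrow> coherent) \<and>
       (coherent \<longrightarrow>
          module_isomorphic int_cring (directed_homology int_cring K 1) (regular_module int_cring))) \<and>
      ((nontrivial_module (directed_homology rat_cring K 1) \<longleftrightarrow> coherent) \<and>
       (coherent \<longrightarrow>
          module_isomorphic rat_cring (directed_homology rat_cring K 1) (regular_module rat_cring))) \<and>
      ((nontrivial_module (directed_homology real_cring K 1) \<longleftrightarrow> coherent) \<and>
       (coherent \<longrightarrow>
          module_isomorphic real_cring (directed_homology real_cring K 1) (regular_module real_cring))))"
proof -
  interpret polygon V K v e n
  proof
    show "simplices K (Suc 1) = {}"
      using assms(3) by (simp add: one_dimensional_def numeral_2_eq_2)
    show "v (Suc n) = v 0" using assms(7) by simp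
    show "e i = [v i, v (Suc i)] \<or> e i = [v (Suc i), v i]" if "i \<in> {0..n}" for i
      using bspec[OF assms(10) that] by simp
  qed (rule assms)+
  have coherent_eq: "(\<forall>i\<in>{0..n}. e i = [v i, v (i + 1)]) \<or> (\<forall>i\<in>{0..n}. e i = [v (i + 1), v i])
      \<longleftrightarrow> coherent"
    by (simp add: forward_def One_nat_def)
  show ?thesis
    unfolding Let_def coherent_eq
    by (intro conjI[OF homology_isomorphic[OF \<open>cring R\<close>]] conjI[OF directed_homology_dichotomy]
        directed_homology_dichotomy)
qed

end
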